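(* Let $p$ be an odd prime and let $G$ be a finite non-abelian $p^{2}$-abelian $p$-central $p$-group with $|G|\ge p^{3}$. Suppose that the centre $Z(G)$ of $G$ satisfies \[ Z(G)\cong \mathbb{Z}/p^{e_{1}}\mathbb{Z}\times\cdots\times\mathbb{Z}/p^{e_{n}}\mathbb{Z} \] for integers $3\le e_{1}\le\cdots\le e_{n}$ and $n\ge 3$. Then $|G|$ divides $|\mathrm{Aut}(G)|$, where $\mathrm{Aut}(G)$ is the group of automorphisms of $G$.
   Context: A $p$-group $G$ is called $p$-central if $G^{p}\le Z(G)$, where $G^{p}=\langle x^{p} : x\in G\rangle$ (equivalently, $x^{p}\in Z(G)$ for all $x\in G$). A group $G$ is called $p^{2}$-abelian if $(xy)^{p^{2}}=x^{p^{2}}y^{p^{2}}$ for all $x,y\in G$. *)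

theory Defs
  imports "HOL-Algebra.Algebra"
begin

definition center :: "('a, 'b) monoid_scheme \<Rightarrow> 'a set"
  where "center G = {z \<in> carrier G. \<forall>x \<in> carrier G. z \<otimes>\<^bsub>G\<^esub> x = x \<otimes>\<^bsub>G\<^esub> z}"

definition center_group :: "('a, 'b) monoid_scheme \<Rightarrow> ('a, 'b) monoid_scheme"
  where "center_group G = G \<lparr>carrier := center G\<rparr>"

definition finite_p_group :: "nat \<Rightarrow> ('a, 'b) monoid_scheme \<Rightarrow> bool"
  where "finite_p_group p G \<longleftrightarrow> group G \<and> finite (carrier G) \<and> (\<exists>k. order G = p ^ k)"

definition power_subgroup :: "nat \<Rightarrow> ('a, 'b) monoid_scheme \<Rightarrow> 'a set"
  where "power_subgroup m G = generate G {x [^]\<^bsub>G\<^esub> m | x. x \<in> carrier G}"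

definition p_central :: "nat \<Rightarrow> ('a, 'b) monoid_scheme \<Rightarrow> bool"
  where "p_central p G \<longleftrightarrow> power_subgroup p G \<subseteq> center G"

text \<open>A group is \<open>p\<^sup>2\<close>-abelian if it satisfies the following predicate for \<open>m = p\<^sup>2\<close>.\<close>

definition power_abelian :: "nat \<Rightarrow> ('a, 'b) monoid_scheme \<Rightarrow> bool"
  where "power_abelian m G \<longleftrightarrow>
    (\<forall>x \<in> carrier G. \<forall>y \<in> carrier G.
      (x \<otimes>\<^bsub>G\<^esub> y) [^]\<^bsub>G\<^esub> m = x [^]\<^bsub>G\<^esub> m \<otimes>\<^bsub>G\<^esub> y [^]\<^bsub>G\<^esub> m)"

end

theory Submission
  imports Defs
begin

text \<open>
  Write \<open>Z\<close> for the centre of \<open>G\<close>. Restriction to \<open>Z\<close> is a homomorphism from the automorphism group of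
  \<open>G\<close> to the permutations of \<open>Z\<close>, so \<open>|Aut G|\<close> is the order of its kernel times the order of its image.
  The inner automorphisms lie in the kernel, whose order is therefore divisible by \<open>|G/Z|\<close>. It remains to
  find a group of permutations of \<open>Z\<close> that extend to automorphisms of \<open>G\<close> and whose order is divisible
  by \<open>|Z|\<close>; this reduction is \<open>order_dvd_order_AutoGroup_if_center_automorphisms_extend\<close>.

  Since \<open>G\<close> is \<open>p\<close>-central and \<open>p\<^sup>2\<close>-abelian, \<open>x \<mapsto> x\<^bsup>p\<^sup>2\<^esup>\<close> is a homomorphism from \<open>G\<close> to \<open>Z\<close>. Hence every
  endomorphism \<open>\<alpha>\<close> of \<open>Z\<close> yields an endomorphism \<open>x \<mapsto> x \<alpha>(x\<^bsup>p\<^sup>2\<^esup>)\<close> of \<open>G\<close>. It is bijective because the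
  perturbation strictly lowers the order of an element (\<open>power_twist_in_auto\<close>). On \<open>Z\<close>, written
  additively, it is \<open>1 + p\<^sup>2\<alpha>\<close>, and maps of this form are closed under composition:
  \<open>(1 + p\<^sup>2\<alpha>)(1 + p\<^sup>2\<beta>) = 1 + p\<^sup>2(\<alpha> + \<beta> + p\<^sup>2\<alpha>\<beta>)\<close>.

  The number of such maps is counted with integer matrices. For \<open>Z \<cong> \<Prod>\<^sub>i \<int>/p\<^bsup>e\<^sub>i\<^esup>\<close>, the entry of \<open>p\<^sup>2\<alpha>\<close> in
  position \<open>(i, j)\<close> is a multiple of \<open>p\<close> to the power \<open>2 + max(0, e\<^sub>i - e\<^sub>j)\<close> and matters modulo
  \<open>p\<^bsup>e\<^sub>i\<^esup>\<close>, which leaves \<open>p\<close> to the power \<open>min(e\<^sub>i, e\<^sub>j) - 2\<close> choices (\<open>card_twists\<close>). Row \<open>i\<close> thus contributes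
  the exponent \<open>e\<^sub>i - 2\<close> on the diagonal and, as all \<open>e\<^sub>j \<ge> 3\<close>, at least \<open>1\<close> for each of the \<open>n - 1 \<ge> 2\<close>
  other positions. Together that is at least \<open>e\<^sub>i\<close>, so the number of maps, a power of \<open>p\<close>, is divisible
  by \<open>\<Prod>\<^sub>i p\<^bsup>e\<^sub>i\<^esup> = |Z|\<close> (\<open>card_M_dvd_card_twists\<close>).
\<close>

section \<open>Orders of kernels and images\<close>

lemma (in group_hom) order_eq_card_kernel_times_card_image:
  "order G = card (kernel G H h) * card (h ` carrier G)"
proof -
  let ?I = "H\<lparr>carrier := h ` carrier G\<rparr>"
  have "group ?I"
    using img_is_subgroup by (rule subgroup.subgroup_is_group) (rule H.is_group)
  then interpret I: group_hom G ?I h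
    by (simp add: group_hom_def group_hom_axioms_def hom_def)
  have ker: "kernel G ?I h = kernel G H h"
    by (simp add: kernel_def)
  have "(G Mod kernel G H h) \<cong> ?I"
    using I.FactGroup_iso by (simp add: ker)
  then have "card (rcosets kernel G H h) = card (h ` carrier G)"
    using iso_same_card by (fastforce simp: FactGroup_def)
  then show ?thesis
    using G.lagrange[OF subgroup_kernel] by (simp add: mult.commute)
qed

lemma (in group) card_subgroup_dvd_card_subgroup:
  assumes "subgroup H G" "subgroup K G" "H \<subseteq> K"
  shows "card H dvd card K"
proof -
  interpret K: group "G\<lparr>carrier := K\<rparr>"
    using assms(2) by (rule subgroup.subgroup_is_group) (rule is_group)
  have "subgroup H (G\<lparr>carrier := K\<rparr>)"
    using assms by (rule subgroup_incl)
  then have "card (rcosets\<^bsub>G\<lparr>carrier := K\<rparr>\<^esub> H) * card H = card K"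
    using K.lagrange by (simp add: order_def)
  then show ?thesis
    using dvd_triv_right by metis
qed

text \<open>
  In a finite multiplicatively closed set, translation by an element of the set is injective, hence
  onto; solving \<open>x y = x\<close> and \<open>x y = 1\<close> gives the unit and the inverses.
\<close>

lemma (in group) finite_mult_closed_imp_subgroup:
  assumes fin: "finite H" and sub: "H \<subseteq> carrier G" and ne: "H \<noteq> {}"
    and cl: "\<And>x y. x \<in> H \<Longrightarrow> y \<in> H \<Longrightarrow> x \<otimes> y \<in> H"
  shows "subgroup H G"
proof -
  have onto: "(\<lambda>y. x \<otimes> y) ` H = H" if "x \<in> H" for x
  proof (rule endo_inj_surj[OF fin])
    show "(\<lambda>y. x \<otimes> y) ` H \<subseteq> H" using that cl by blast
    show "inj_on (\<lambda>y. x \<otimes> y) H" using that sub by (meson inj_onI l_cancel subsetD)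
  qed
  have one: "\<one> \<in> H"
  proof -
    obtain x where x: "x \<in> H" using ne by blast
    then have "x \<in> (\<lambda>y. x \<otimes> y) ` H" by (simp only: onto)
    then obtain y where y: "y \<in> H" "x = x \<otimes> y" by blast
    have "x \<otimes> y = x \<otimes> \<one>" using x y(2) sub by auto
    then have "y = \<one>" using x y(1) sub by (meson l_cancel one_closed subsetD)
    then show ?thesis using y(1) by simp
  qed
  show ?thesis
  proof (rule subgroupI[OF sub ne])
    fix x assume x: "x \<in> H"
    have "\<one> \<in> (\<lambda>y. x \<otimes> y) ` H" using x one by (simp only: onto)
    then obtain y where y: "y \<in> H" "\<one> = x \<otimes> y" by blast
    then have "inv y = x"
      using x sub by (intro inv_equality) auto
    then have "inv x = y" using y(1) sub by auto
    then show "inv x \<in> H" using y(1) by simp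
  qed (rule cl)
qed

section \<open>Restricting automorphisms to the centre\<close>

lemma (in group) subgroup_center: "subgroup (center G) G"
proof (rule subgroupI)
  show "center G \<noteq> {}" by (auto simp: center_def intro!: exI[of _ \<one>])
next
  fix a assume a: "a \<in> center G"
  show "inv a \<in> center G"
    unfolding center_def
  proof (intro CollectI conjI ballI)
    show "inv a \<in> carrier G" using a by (simp add: center_def)
    fix x assume x: "x \<in> carrier G"
    have ac: "a \<in> carrier G" using a by (simp add: center_def)
    have "inv (inv x \<otimes> a) = inv (a \<otimes> inv x)" using a x by (simp add: center_def)
    then show "inv a \<otimes> x = x \<otimes> inv a"
      using ac x by (simp add: inv_mult_group)
  qed
next
  fix a b assume "a \<in> center G" "b \<in> center G"
  then have ab: "a \<in> carrier G" "b \<in> carrier G"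
    and comm: "\<And>x. x \<in> carrier G \<Longrightarrow> a \<otimes> x = x \<otimes> a" "\<And>x. x \<in> carrier G \<Longrightarrow> b \<otimes> x = x \<otimes> b"
    by (auto simp: center_def)
  have "a \<otimes> b \<otimes> x = x \<otimes> (a \<otimes> b)" if x: "x \<in> carrier G" for x
  proof -
    have "a \<otimes> b \<otimes> x = a \<otimes> x \<otimes> b" using ab x comm(2)[OF x] by (simp add: m_assoc)
    also have "\<dots> = x \<otimes> (a \<otimes> b)" using ab x comm(1)[OF x] by (simp add: m_assoc)
    finally show ?thesis .
  qed
  then show "a \<otimes> b \<in> center G" using ab by (simp add: center_def)
qed (auto simp: center_def)

lemma (in group) group_center_group: "group (center_group G)"
  unfolding center_group_def
  using subgroup_center by (rule subgroup.subgroup_is_group) (rule is_group)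

lemma (in group) kernel_conjugation:
  "kernel G (BijGroup (carrier G)) (\<lambda>g. \<lambda>x\<in>carrier G. g \<otimes> x \<otimes> inv g) = center G"
proof -
  have "g \<otimes> x \<otimes> inv g = x \<longleftrightarrow> g \<otimes> x = x \<otimes> g" if "g \<in> carrier G" "x \<in> carrier G" for g x
    using that by (metis inv_solve_right m_closed)
  then show ?thesis
    by (auto simp: kernel_def center_def BijGroup_def restrict_def fun_eq_iff)
qed

text \<open>
  An automorphism is onto, so commuting with every element is the same as commuting with every image.
\<close>

lemma (in group) auto_image_center_subset:
  assumes f: "f \<in> auto G" and z: "z \<in> center G"
  shows "f z \<in> center G"
proof -
  have bij: "f ` carrier G = carrier G" and hom: "f \<in> hom G G"
    using f by (auto simp: auto_def Bij_def bij_betw_def)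
  have zc: "z \<in> carrier G" using z by (simp add: center_def)
  show ?thesis
    unfolding center_def
  proof (intro CollectI conjI ballI)
    show "f z \<in> carrier G" using hom zc by (rule hom_in_carrier)
    fix y assume "y \<in> carrier G"
    then obtain x where x: "x \<in> carrier G" "y = f x" using bij by (metis imageE)
    have "f (z \<otimes> x) = f (x \<otimes> z)" using z x by (simp add: center_def)
    then show "f z \<otimes> y = y \<otimes> f z" using hom_mult[OF hom] zc x by simp
  qed
qed

lemma (in group) restrict_center_in_Bij:
  assumes fin: "finite (carrier G)" and f: "f \<in> auto G"
  shows "restrict f (center G) \<in> Bij (center G)"
proof -
  have sub: "center G \<subseteq> carrier G" by (auto simp: center_def)
  have inj: "inj_on f (center G)"
    using f sub by (auto simp: auto_def Bij_def bij_betw_def intro: inj_on_subset)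
  have "f ` center G = center G"
    using auto_image_center_subset[OF f] inj finite_subset[OF sub fin] 
    by (intro endo_inj_surj) auto
  then show ?thesis using inj by (simp add: Bij_def bij_betw_def)
qed

lemma (in group) restrict_center_hom:
  assumes fin: "finite (carrier G)"
  shows "(\<lambda>f. restrict f (center G)) \<in> hom (AutoGroup G) (BijGroup (center G))"
proof (rule homI)
  fix f assume "f \<in> carrier (AutoGroup G)"
  then show "restrict f (center G) \<in> carrier (BijGroup (center G))"
    using restrict_center_in_Bij[OF fin] by (simp add: AutoGroup_def BijGroup_def)
next
  fix f g assume "f \<in> carrier (AutoGroup G)" "g \<in> carrier (AutoGroup G)"
  then have fg: "f \<in> auto G" "g \<in> auto G" by (simp_all add: AutoGroup_def)
  then have B: "f \<in> Bij (carrier G)" "g \<in> Bij (carrier G)" by (simp_all add: auto_def)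
  have sub: "z \<in> carrier G" if "z \<in> center G" for z using that by (simp add: center_def)
  show "restrict (f \<otimes>\<^bsub>AutoGroup G\<^esub> g) (center G) =
      restrict f (center G) \<otimes>\<^bsub>BijGroup (center G)\<^esub> restrict g (center G)"
    using B fg restrict_center_in_Bij[OF fin] auto_image_center_subset
    by (auto simp: AutoGroup_def BijGroup_def compose_def fun_eq_iff sub)
qed

text \<open>
  Divisors of the orders of kernel and image of the restriction map are found separately: inner
  automorphisms fix the centre pointwise and number \<open>|G/Z(G)|\<close>, while the image contains \<open>S\<close>, whose
  order takes care of the factor \<open>|Z(G)|\<close>.
\<close>

theorem (in group) order_dvd_order_AutoGroup_if_center_automorphisms_extend:
  assumes fin: "finite (carrier G)"
    and S: "subgroup S (BijGroup (center G))"
    and ext: "\<And>s. s \<in> S \<Longrightarrow> \<exists>f \<in> auto G. s = restrict f (center G)"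
    and dvd: "card (center G) dvd card S"
  shows "order G dvd order (AutoGroup G)"
proof -
  let ?A = "AutoGroup G" and ?B = "BijGroup (center G)" and ?P = "BijGroup (carrier G)"
  let ?r = "\<lambda>f. restrict f (center G)"
  let ?c = "\<lambda>g. \<lambda>x\<in>carrier G. g \<otimes> x \<otimes> inv g"
  interpret A: group ?A by (rule AutoGroup)
  interpret B: group ?B by (rule group_BijGroup)
  interpret P: group ?P by (rule group_BijGroup)
  interpret c: group_hom G ?P ?c
    by (simp add: group_hom_def group_hom_axioms_def conjugation_is_hom is_group P.is_group)
  interpret r: group_hom ?A ?B ?r
    using restrict_center_hom[OF fin]
    by (simp add: group_hom_def group_hom_axioms_def A.is_group B.is_group)
  have c_auto: "?c ` carrier G \<subseteq> auto G"
  proof (rule image_subsetI)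
    fix g assume g: "g \<in> carrier G"
    have "?c g \<in> hom G G"
      using g by (intro homI) (simp_all add: m_assoc inv_solve_left)
    then show "?c g \<in> auto G"
      using conjugation_is_bij[OF g] by (simp add: auto_def Bij_def)
  qed
  have c_ker: "?c ` carrier G \<subseteq> kernel ?A ?B ?r"
  proof (rule image_subsetI)
    fix g assume g: "g \<in> carrier G"
    have "g \<otimes> z \<otimes> inv g = z" if "z \<in> center G" for z
    proof -
      have z: "z \<in> carrier G" "g \<otimes> z = z \<otimes> g" using that g by (auto simp: center_def)
      then show ?thesis using g by (simp add: m_assoc)
    qed
    moreover have "z \<in> carrier G" if "z \<in> center G" for z using that by (simp add: center_def)
    ultimately have "?r (?c g) = \<one>\<^bsub>?B\<^esub>"
      by (auto simp: BijGroup_def fun_eq_iff)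
    then show "?c g \<in> kernel ?A ?B ?r"
      using c_auto g by (auto simp: kernel_def AutoGroup_def)
  qed
  have "subgroup (?c ` carrier G) ?A"
    unfolding AutoGroup_def using c.img_is_subgroup subgroup_auto c_auto by (rule P.subgroup_incl)
  then have "card (?c ` carrier G) dvd card (kernel ?A ?B ?r)"
    using r.subgroup_kernel c_ker by (rule A.card_subgroup_dvd_card_subgroup)
  moreover have "S \<subseteq> ?r ` carrier ?A"
    using ext by (fastforce simp: AutoGroup_def)
  then have "card S dvd card (?r ` carrier ?A)"
    by (rule B.card_subgroup_dvd_card_subgroup[OF S r.img_is_subgroup])
  then have "card (center G) dvd card (?r ` carrier ?A)"
    using dvd by (rule dvd_trans[rotated])
  ultimately have "card (?c ` carrier G) * card (center G) dvd order ?A"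
    unfolding r.order_eq_card_kernel_times_card_image by (rule mult_dvd_mono)
  moreover have "order G = card (?c ` carrier G) * card (center G)"
    using c.order_eq_card_kernel_times_card_image by (simp add: kernel_conjugation mult.commute)
  ultimately show ?thesis by simp
qed

section \<open>Central automorphisms from power maps\<close>

text \<open>
  The map is multiplicative because the \<open>m\<close>-th power map is a homomorphism into the centre. It is
  injective because \<open>x = \<alpha>(x\<^sup>m)\<^sup>-\<^sup>1\<close> is self-improving: if \<open>x\<close> is killed by \<open>m\<^sup>j\<^sup>+\<^sup>1\<close>, then \<open>\<alpha>(x\<^sup>m)\<close>, and with it
  \<open>x\<close>, is already killed by \<open>m\<^sup>j\<close>. Descending from the exponent \<open>m\<^sup>k\<close> of the group leaves only \<open>x = 1\<close>.
\<close>

theorem (in group) power_twist_in_auto: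
  assumes fin: "finite (carrier G)"
    and ab: "power_abelian m G"
    and central: "\<And>x. x \<in> carrier G \<Longrightarrow> x [^] m \<in> center G"
    and exp: "\<And>x. x \<in> carrier G \<Longrightarrow> x [^] (m ^ k) = \<one>"
    and \<alpha>: "\<alpha> \<in> hom (center_group G) (center_group G)"
  shows "(\<lambda>x\<in>carrier G. x \<otimes> \<alpha> (x [^] m)) \<in> auto G"
proof -
  let ?f = "\<lambda>x\<in>carrier G. x \<otimes> \<alpha> (x [^] m)"
  have Z: "z \<in> carrier G" if "z \<in> center G" for z using that by (simp add: center_def)
  have \<alpha>Z: "\<alpha> z \<in> center G" if "z \<in> center G" for z
    using hom_in_carrier[OF \<alpha>] that by (simp add: center_group_def)
  have \<alpha>mult: "\<alpha> (y \<otimes> z) = \<alpha> y \<otimes> \<alpha> z" if "y \<in> center G" "z \<in> center G" for y z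
    using hom_mult[OF \<alpha>] that by (simp add: center_group_def)
  interpret Z: group "center_group G" by (rule group_center_group)
  interpret \<alpha>: group_hom "center_group G" "center_group G" \<alpha>
    using \<alpha> by (simp add: group_hom_def group_hom_axioms_def Z.is_group)
  have \<alpha>pow: "\<alpha> (z [^] j) = \<alpha> z [^] j" if "z \<in> center G" for z and j :: nat
    using \<alpha>.hom_nat_pow[of z j] that
    by (simp add: center_group_def nat_pow_consistent[symmetric])
  have \<alpha>one: "\<alpha> \<one> = \<one>"
    using \<alpha>.hom_one by (simp add: center_group_def)
  have comm: "\<alpha> (x [^] m) \<otimes> y = y \<otimes> \<alpha> (x [^] m)" if "x \<in> carrier G" "y \<in> carrier G" for x y
    using \<alpha>Z[OF central[OF that(1)]] that(2) by (simp add: center_def)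
  have \<alpha>c: "\<alpha> (x [^] m) \<in> carrier G" if "x \<in> carrier G" for x
    using \<alpha>Z[OF central[OF that]] by (rule Z)
  have hom: "?f \<in> hom G G"
  proof (rule homI)
    fix x y assume x: "x \<in> carrier G" and y: "y \<in> carrier G"
    have "\<alpha> ((x \<otimes> y) [^] m) = \<alpha> (x [^] m) \<otimes> \<alpha> (y [^] m)"
      using ab x y by (simp add: power_abelian_def \<alpha>mult central)
    moreover have "x \<otimes> y \<otimes> (\<alpha> (x [^] m) \<otimes> \<alpha> (y [^] m)) = x \<otimes> (y \<otimes> \<alpha> (x [^] m)) \<otimes> \<alpha> (y [^] m)"
      using x y by (simp add: m_assoc \<alpha>c)
    moreover have "x \<otimes> (y \<otimes> \<alpha> (x [^] m)) \<otimes> \<alpha> (y [^] m) = x \<otimes> \<alpha> (x [^] m) \<otimes> (y \<otimes> \<alpha> (y [^] m))"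
      unfolding comm[OF x y, symmetric] using x y by (simp add: m_assoc \<alpha>c)
    ultimately show "?f (x \<otimes> y) = ?f x \<otimes> ?f y"
      using x y by simp
  qed (simp add: \<alpha>c)
  then interpret f: group_hom G G ?f
    by (simp add: group_hom_def group_hom_axioms_def is_group)
  have trivial: "x = \<one>" if x: "x \<in> carrier G" and fx: "x \<otimes> \<alpha> (x [^] m) = \<one>" for x
  proof -
    have "x = \<one>" if "x [^] (m ^ j) = \<one>" for j
      using that
    proof (induction j)
      case 0
      then show ?case using x by simp
    next
      case (Suc j)
      have "\<alpha> (x [^] m) [^] (m ^ j) = \<alpha> ((x [^] m) [^] (m ^ j))"
        using x by (simp add: \<alpha>pow central)
      also have "\<dots> = \<one>"
        using Suc.prems x by (simp add: nat_pow_pow \<alpha>one)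
      finally have "(x \<otimes> \<alpha> (x [^] m)) [^] (m ^ j) = x [^] (m ^ j)"
        using x by (simp add: pow_mult_distrib comm \<alpha>c)
      then show ?case using fx Suc.IH by simp
    qed
    then show ?thesis using exp[OF x] by blast
  qed
  have "kernel G G ?f = {\<one>}"
  proof (intro equalityI subsetI)
    fix x assume "x \<in> kernel G G ?f"
    then have "x \<in> carrier G" "x \<otimes> \<alpha> (x [^] m) = \<one>" by (auto simp: kernel_def)
    then show "x \<in> {\<one>}" using trivial by simp
  qed (simp add: kernel_def \<alpha>one)
  then have inj: "inj_on ?f (carrier G)" by (simp only: f.inj_iff_trivial_ker)
  then have "?f ` carrier G = carrier G"
    using hom_in_carrier[OF hom] by (intro endo_inj_surj[OF fin]) auto
  then show ?thesis using hom inj by (simp add: auto_def Bij_def bij_betw_def)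
qed

section \<open>Matrix automorphisms of a product of cyclic groups\<close>

locale cyclic_factors =
  fixes p :: nat and I :: "'i set" and e :: "'i \<Rightarrow> nat"
  assumes finite_I: "finite I" and p_gt_1: "1 < p" and e_ge_2: "\<And>i. i \<in> I \<Longrightarrow> 2 \<le> e i"
begin

definition M :: "('i \<Rightarrow> int) monoid"
  where "M = product_group I (\<lambda>i. integer_mod_group (p ^ e i))"

text \<open>
  A matrix entry \<open>K i j\<close> sends the generator of the \<open>j\<close>-th factor, of order \<open>p ^ e j\<close>, into the \<open>i\<close>-th
  factor; this is well defined exactly if \<open>p ^ e i\<close> divides \<open>p ^ e j * K i j\<close>. With the truncated
  subtraction of natural numbers this is divisibility by \<open>p ^ (e i - e j)\<close> in both cases
  \<open>e i \<le> e j\<close> and \<open>e j \<le> e i\<close>.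
\<close>

definition compatible :: "('i \<Rightarrow> 'i \<Rightarrow> int) \<Rightarrow> bool"
  where "compatible K \<longleftrightarrow> (\<forall>i\<in>I. \<forall>j\<in>I. int p ^ (e i - e j) dvd K i j)"

definition matrix_map :: "('i \<Rightarrow> 'i \<Rightarrow> int) \<Rightarrow> ('i \<Rightarrow> int) \<Rightarrow> ('i \<Rightarrow> int)"
  where "matrix_map K x = (\<lambda>i\<in>I. (\<Sum>j\<in>I. K i j * x j) mod int p ^ e i)"

text \<open>
  This is the map \<open>1 + p\<^sup>2K\<close>, with all components reduced.
\<close>

definition twist :: "('i \<Rightarrow> 'i \<Rightarrow> int) \<Rightarrow> ('i \<Rightarrow> int) \<Rightarrow> ('i \<Rightarrow> int)"
  where "twist K x = (\<lambda>i\<in>I. (x i + int p ^ 2 * (\<Sum>j\<in>I. K i j * x j)) mod int p ^ e i)"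

lemma group_M: "group M"
  by (simp add: M_def)

lemma carrier_M: "carrier M = (\<Pi>\<^sub>E i\<in>I. {0..<int p ^ e i})"
  using p_gt_1 by (simp add: M_def carrier_integer_mod_group)

lemma mult_M: "x \<otimes>\<^bsub>M\<^esub> y = (\<lambda>i\<in>I. (x i + y i) mod int p ^ e i)"
  by (simp add: M_def)

lemma pow_M:
  assumes "x \<in> carrier M"
  shows "x [^]\<^bsub>M\<^esub> (k::nat) = (\<lambda>i\<in>I. (int k * x i) mod int p ^ e i)"
proof (induction k)
  case (Suc k)
  then show ?case
    by (simp add: mult_M fun_eq_iff mod_add_left_eq mod_add_right_eq algebra_simps)
qed (simp add: M_def fun_eq_iff)

lemma mod_in_M: "(\<lambda>i\<in>I. f i mod int p ^ e i) \<in> carrier M"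
  unfolding carrier_M using p_gt_1 by simp

text \<open>
  This is where compatibility enters: reducing the arguments, each modulo its own \<open>p ^ e j\<close>, does not
  affect the \<open>i\<close>-th component. Additivity and the composition law of twists both follow from it.
\<close>

lemma compatible_sum_mod:
  assumes "compatible K" and i: "i \<in> I"
  shows "(\<Sum>j\<in>I. K i j * (x j mod int p ^ e j)) mod int p ^ e i = (\<Sum>j\<in>I. K i j * x j) mod int p ^ e i"
proof -
  have "K i j * (x j mod int p ^ e j) mod int p ^ e i = K i j * x j mod int p ^ e i" if j: "j \<in> I" for j
  proof -
    have "int p ^ (e i - e j) * int p ^ e j dvd K i j * (x j mod int p ^ e j - x j)"
      using assms j by (intro mult_dvd_mono) (auto simp: compatible_def mod_eq_dvd_iff[symmetric])
    moreover have "int p ^ e i dvd int p ^ (e i - e j) * int p ^ e j"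
      by (simp add: le_imp_power_dvd flip: power_add)
    ultimately have "int p ^ e i dvd K i j * (x j mod int p ^ e j) - K i j * x j"
      using dvd_trans by (metis right_diff_distrib)
    then show ?thesis by (simp add: mod_eq_dvd_iff)
  qed
  then have "(\<Sum>j\<in>I. K i j * (x j mod int p ^ e j) mod int p ^ e i) = (\<Sum>j\<in>I. K i j * x j mod int p ^ e i)"
    by (rule sum.cong[OF refl])
  then have "(\<Sum>j\<in>I. K i j * (x j mod int p ^ e j) mod int p ^ e i) mod int p ^ e i
      = (\<Sum>j\<in>I. K i j * x j mod int p ^ e i) mod int p ^ e i"
    by (rule arg_cong)
  then show ?thesis by (simp only: mod_sum_eq)
qed

lemma matrix_map_hom:
  assumes "compatible K"
  shows "matrix_map K \<in> hom M M"
proof (rule homI)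
  fix x y assume "x \<in> carrier M" "y \<in> carrier M"
  have "(\<Sum>j\<in>I. K i j * ((x j + y j) mod int p ^ e j)) mod int p ^ e i
      = ((\<Sum>j\<in>I. K i j * x j) mod int p ^ e i + (\<Sum>j\<in>I. K i j * y j) mod int p ^ e i) mod int p ^ e i"
    if "i \<in> I" for i
    using compatible_sum_mod[OF assms that, of "\<lambda>j. x j + y j"]
    by (simp add: mod_add_eq distrib_left sum.distrib)
  then show "matrix_map K (x \<otimes>\<^bsub>M\<^esub> y) = matrix_map K x \<otimes>\<^bsub>M\<^esub> matrix_map K y"
    by (simp add: matrix_map_def mult_M fun_eq_iff)
qed (simp only: matrix_map_def mod_in_M)

text \<open>
  The form in which twists extend from the centre to the whole group.
\<close>

lemma twist_eq_mult_pow: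
  assumes "x \<in> carrier M"
  shows "twist K x = x \<otimes>\<^bsub>M\<^esub> matrix_map K x [^]\<^bsub>M\<^esub> (p\<^sup>2)"
proof -
  have K: "matrix_map K x \<in> carrier M" by (simp only: matrix_map_def mod_in_M)
  show ?thesis
    unfolding mult_M pow_M[OF K]
    by (simp add: twist_def matrix_map_def fun_eq_iff mod_mult_right_eq mod_add_right_eq)
qed

text \<open>
  The matrix identity \<open>(1 + p\<^sup>2K)(1 + p\<^sup>2L) = 1 + p\<^sup>2(K + L + p\<^sup>2KL)\<close>.
\<close>

lemma twist_twist:
  assumes "compatible K"
  shows "twist K (twist L x) = twist (\<lambda>i j. K i j + L i j + int p ^ 2 * (\<Sum>l\<in>I. K i l * L l j)) x"
proof -
  define y where "y i = x i + int p ^ 2 * (\<Sum>j\<in>I. L i j * x j)" for i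
  let ?N = "\<lambda>i j. K i j + L i j + int p ^ 2 * (\<Sum>l\<in>I. K i l * L l j)"
  have "(twist L x i + int p ^ 2 * (\<Sum>j\<in>I. K i j * twist L x j)) mod int p ^ e i
      = (x i + int p ^ 2 * (\<Sum>j\<in>I. ?N i j * x j)) mod int p ^ e i" if i: "i \<in> I" for i
  proof -
    have "(\<Sum>j\<in>I. K i j * twist L x j) = (\<Sum>j\<in>I. K i j * (y j mod int p ^ e j))"
      by (intro sum.cong) (auto simp: twist_def y_def)
    then have *: "(\<Sum>j\<in>I. K i j * twist L x j) mod int p ^ e i = (\<Sum>j\<in>I. K i j * y j) mod int p ^ e i"
      using compatible_sum_mod[OF assms i] by simp
    have "(\<Sum>j\<in>I. K i j * y j) = (\<Sum>j\<in>I. K i j * x j) + int p ^ 2 * (\<Sum>l\<in>I. K i l * (\<Sum>j\<in>I. L l j * x j))"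
      by (simp add: y_def distrib_left sum.distrib mult.left_commute[of _ "int p ^ 2"] flip: sum_distrib_left)
    moreover have "(\<Sum>l\<in>I. K i l * (\<Sum>j\<in>I. L l j * x j)) = (\<Sum>j\<in>I. (\<Sum>l\<in>I. K i l * L l j) * x j)"
      unfolding sum_distrib_left sum_distrib_right mult.assoc by (rule sum.swap)
    moreover have "(\<Sum>j\<in>I. ?N i j * x j) = (\<Sum>j\<in>I. K i j * x j) + (\<Sum>j\<in>I. L i j * x j)
        + int p ^ 2 * (\<Sum>j\<in>I. (\<Sum>l\<in>I. K i l * L l j) * x j)"
      by (simp add: distrib_right sum.distrib mult.assoc flip: sum_distrib_left)
    ultimately have "y i + int p ^ 2 * (\<Sum>j\<in>I. K i j * y j) = x i + int p ^ 2 * (\<Sum>j\<in>I. ?N i j * x j)"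
      by (simp only: y_def distrib_left add_ac)
    moreover have "(twist L x i + int p ^ 2 * (\<Sum>j\<in>I. K i j * twist L x j)) mod int p ^ e i
        = (y i + int p ^ 2 * (\<Sum>j\<in>I. K i j * y j)) mod int p ^ e i"
    proof (rule mod_add_cong[OF _ mod_mult_cong[OF refl *]])
      show "twist L x i mod int p ^ e i = y i mod int p ^ e i"
        using i by (simp add: twist_def y_def)
    qed
    ultimately show ?thesis by simp
  qed
  then show ?thesis
    unfolding twist_def[of K] twist_def[of ?N] by (auto simp: fun_eq_iff)
qed

text \<open>
  For the product \<open>KL\<close> the point is that truncated differences satisfy the triangle inequality
  \<open>e i - e j \<le> (e i - e l) + (e l - e j)\<close>.
\<close>

lemma compatible_compose:
  assumes "compatible K" "compatible L"
  shows "compatible (\<lambda>i j. K i j + L i j + int p ^ 2 * (\<Sum>l\<in>I. K i l * L l j))"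
  unfolding compatible_def
proof (intro ballI)
  fix i j assume ij: "i \<in> I" "j \<in> I"
  have "int p ^ (e i - e j) dvd K i l * L l j" if l: "l \<in> I" for l
  proof -
    have "int p ^ (e i - e j) dvd int p ^ (e i - e l) * int p ^ (e l - e j)"
      by (simp add: le_imp_power_dvd flip: power_add)
    also have "\<dots> dvd K i l * L l j"
      using assms ij l by (intro mult_dvd_mono) (auto simp: compatible_def)
    finally show ?thesis .
  qed
  then have "int p ^ (e i - e j) dvd int p ^ 2 * (\<Sum>l\<in>I. K i l * L l j)"
    by (intro dvd_mult[OF dvd_sum])
  then show "int p ^ (e i - e j) dvd K i j + L i j + int p ^ 2 * (\<Sum>l\<in>I. K i l * L l j)"
    using assms ij by (simp add: compatible_def)
qed

lemma p_squared_times_power: "i \<in> I \<Longrightarrow> int p ^ 2 * int p ^ (e i - 2) = int p ^ e i"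
  by (metis e_ge_2 le_add_diff_inverse power_add)

text \<open>
  The factor \<open>p\<^sup>2\<close> makes row \<open>i\<close> of the matrix matter only modulo \<open>p ^ (e i - 2)\<close>. Conversely, evaluation
  at the generator of the \<open>j\<close>-th factor recovers column \<open>j\<close> to exactly this precision
  (\<open>twist_eq_imp_cong\<close>).
\<close>

lemma twist_cong:
  assumes "\<And>i j. i \<in> I \<Longrightarrow> j \<in> I \<Longrightarrow> K i j mod int p ^ (e i - 2) = L i j mod int p ^ (e i - 2)"
  shows "twist K x = twist L x"
proof -
  have "(x i + int p ^ 2 * (\<Sum>j\<in>I. K i j * x j)) mod int p ^ e i
      = (x i + int p ^ 2 * (\<Sum>j\<in>I. L i j * x j)) mod int p ^ e i" if i: "i \<in> I" for i
  proof -
    have "int p ^ (e i - 2) dvd (\<Sum>j\<in>I. (K i j - L i j) * x j)"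
      using assms i by (intro dvd_sum dvd_mult2) (simp add: mod_eq_dvd_iff)
    then have "int p ^ 2 * int p ^ (e i - 2) dvd int p ^ 2 * (\<Sum>j\<in>I. (K i j - L i j) * x j)"
      by (rule mult_dvd_mono[OF dvd_refl])
    then show ?thesis
      using i by (simp add: p_squared_times_power mod_eq_dvd_iff left_diff_distrib sum_subtractf right_diff_distrib)
  qed
  then show ?thesis by (simp add: twist_def fun_eq_iff)
qed

lemma twist_eq_imp_cong:
  assumes eq: "\<And>x. x \<in> carrier M \<Longrightarrow> twist K x = twist L x" and i: "i \<in> I" and j: "j \<in> I"
  shows "K i j mod int p ^ (e i - 2) = L i j mod int p ^ (e i - 2)"
proof -
  \<comment> \<open>The generator of the \<open>j\<close>-th cyclic factor.\<close>
  define u :: "'i \<Rightarrow> int" where "u = (\<lambda>i\<in>I. if i = j then 1 else 0)"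
  have "u \<in> carrier M"
    using p_gt_1 e_ge_2 by (fastforce simp: carrier_M u_def intro!: one_less_power)
  then have "twist K u i = twist L u i" using eq by simp
  moreover have "(\<Sum>l\<in>I. N i l * u l) = N i j" for N :: "'i \<Rightarrow> 'i \<Rightarrow> int"
  proof -
    have "(\<Sum>l\<in>I. N i l * u l) = (\<Sum>l\<in>I. if l = j then N i l else 0)"
      by (intro sum.cong) (auto simp: u_def)
    then show ?thesis using finite_I j by simp
  qed
  ultimately have "int p ^ e i dvd int p ^ 2 * (K i j - L i j)"
    using i by (simp add: twist_def mod_eq_dvd_iff right_diff_distrib)
  then have "int p ^ 2 * int p ^ (e i - 2) dvd int p ^ 2 * (K i j - L i j)"
    by (simp only: p_squared_times_power[OF i])
  then show ?thesis
    using p_gt_1 by (simp add: mod_eq_dvd_iff)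
qed

definition twists :: "(('i \<Rightarrow> int) \<Rightarrow> ('i \<Rightarrow> int)) set"
  where "twists = (\<lambda>K. restrict (twist K) (carrier M)) ` {K. compatible K}"

text \<open>
  A compatible entry is \<open>p ^ (e i - e j) * k\<close>, and it matters modulo \<open>p ^ (e i - 2)\<close>. Hence \<open>k\<close> ranges
  freely over the residues modulo \<open>p ^ (e i - 2 - (e i - e j))\<close>, whose exponent equals
  \<open>min (e i) (e j) - 2\<close>, and choosing such residues for all entries parametrises the twists bijectively.
\<close>

lemma card_twists: "card twists = (\<Prod>i\<in>I. \<Prod>j\<in>I. p ^ (min (e i) (e j) - 2))"
proof -
  define B where "B = (\<lambda>(i,j). {0..<int p ^ (min (e i) (e j) - 2)})"
  define scale where "scale k = (\<lambda>i j. int p ^ (e i - e j) * k (i, j))" for k :: "'i \<times> 'i \<Rightarrow> int"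
  have split: "int p ^ (e i - 2) = int p ^ (e i - e j) * int p ^ (min (e i) (e j) - 2)"
    if "i \<in> I" "j \<in> I" for i j
    using e_ge_2[OF that(1)] e_ge_2[OF that(2)] by (simp add: min_def flip: power_add)
  have "bij_betw (\<lambda>k. restrict (twist (scale k)) (carrier M)) (PiE (I \<times> I) B) twists"
  proof (rule bij_betwI')
    fix k l assume k: "k \<in> PiE (I \<times> I) B" and l: "l \<in> PiE (I \<times> I) B"
    have "k = l" if eq: "restrict (twist (scale k)) (carrier M) = restrict (twist (scale l)) (carrier M)"
    proof (rule PiE_ext[OF k l])
      fix ij assume "ij \<in> I \<times> I"
      then obtain i j where ij: "ij = (i, j)" "i \<in> I" "j \<in> I" by blast
      have "twist (scale k) x = twist (scale l) x" if "x \<in> carrier M" for x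
        using fun_cong[OF eq, of x] that by (simp only: restrict_apply if_True)
      then have "scale k i j mod int p ^ (e i - 2) = scale l i j mod int p ^ (e i - 2)"
        using ij by (intro twist_eq_imp_cong)
      then have "int p ^ (e i - e j) * (k ij mod int p ^ (min (e i) (e j) - 2))
          = int p ^ (e i - e j) * (l ij mod int p ^ (min (e i) (e j) - 2))"
        unfolding split[OF ij(2,3)] mult_mod_right scale_def ij(1) .
      then have "k ij mod int p ^ (min (e i) (e j) - 2) = l ij mod int p ^ (min (e i) (e j) - 2)"
        using p_gt_1 by simp
      moreover have "k ij \<in> B ij" "l ij \<in> B ij" using k l \<open>ij \<in> I \<times> I\<close> by (auto simp: PiE_iff)
      ultimately show "k ij = l ij" by (simp add: B_def ij(1))
    qed
    then show "(restrict (twist (scale k)) (carrier M) = restrict (twist (scale l)) (carrier M)) = (k = l)"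
      by blast
  next
    fix k assume "k \<in> PiE (I \<times> I) B"
    have "compatible (scale k)" by (simp add: compatible_def scale_def)
    then show "restrict (twist (scale k)) (carrier M) \<in> twists" by (auto simp: twists_def)
  next
    fix t assume "t \<in> twists"
    then obtain K where K: "compatible K" and t: "t = restrict (twist K) (carrier M)"
      by (auto simp: twists_def)
    define k where "k = (\<lambda>(i,j)\<in>I \<times> I. K i j div int p ^ (e i - e j) mod int p ^ (min (e i) (e j) - 2))"
    have "k \<in> PiE (I \<times> I) B"
      using p_gt_1 by (auto simp: k_def B_def)
    moreover have "twist K = twist (scale k)"
    proof (rule ext, rule twist_cong)
      fix i j assume ij: "i \<in> I" "j \<in> I"
      let ?d = "int p ^ (e i - e j)" and ?m = "int p ^ (min (e i) (e j) - 2)"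
      have "scale k i j = K i j mod (?d * ?m)"
        using K ij by (simp add: scale_def k_def mult_mod_right compatible_def)
      then show "K i j mod int p ^ (e i - 2) = scale k i j mod int p ^ (e i - 2)"
        by (simp only: split[OF ij] mod_mod_trivial)
    qed
    ultimately show "\<exists>k\<in>PiE (I \<times> I) B. t = restrict (twist (scale k)) (carrier M)"
      unfolding t by (intro bexI[of _ k]) simp_all
  qed
  then have "card twists = card (PiE (I \<times> I) B)"
    by (rule bij_betw_same_card[symmetric])
  also have "\<dots> = (\<Prod>(i,j)\<in>I \<times> I. p ^ (min (e i) (e j) - 2))"
    using finite_I by (subst card_PiE) (auto simp: B_def case_prod_beta nat_power_eq intro!: prod.cong)
  also have "\<dots> = (\<Prod>i\<in>I. \<Prod>j\<in>I. p ^ (min (e i) (e j) - 2))"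
    by (simp add: prod.cartesian_product)
  finally show ?thesis .
qed

lemma twists_closed: "t \<in> twists \<Longrightarrow> x \<in> carrier M \<Longrightarrow> t x \<in> carrier M"
  unfolding twists_def twist_def using mod_in_M by (auto)

lemma compose_twists:
  assumes s: "s \<in> twists" and t: "t \<in> twists"
  shows "compose (carrier M) s t \<in> twists"
proof -
  obtain K L where K: "compatible K" "s = restrict (twist K) (carrier M)"
    and L: "compatible L" "t = restrict (twist L) (carrier M)"
    using s t by (auto simp: twists_def)
  let ?N = "\<lambda>i j. K i j + L i j + int p ^ 2 * (\<Sum>l\<in>I. K i l * L l j)"
  have "compose (carrier M) s t = restrict (twist ?N) (carrier M)"
    using twists_closed[OF t] twist_twist[OF K(1), of L]
    by (auto simp: compose_def fun_eq_iff K(2) L(2))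
  then show ?thesis
    unfolding twists_def using compatible_compose[OF K(1) L(1)] by blast
qed

lemma twists_nonempty: "twists \<noteq> {}"
proof -
  have "compatible (\<lambda>_ _. 0)" by (simp add: compatible_def)
  then show ?thesis unfolding twists_def by blast
qed

lemma finite_twists: "finite twists"
  using card_twists p_gt_1 finite_I card_ge_0_finite[of twists] by (simp add: prod_pos)

lemma card_M: "card (carrier M) = (\<Prod>i\<in>I. p ^ e i)"
  unfolding carrier_M using finite_I by (simp add: card_PiE nat_power_eq)

text \<open>
  Both sides are products over the rows \<open>i\<close>, and divisibility holds row by row. The diagonal entry
  misses the exponent \<open>e i\<close> by \<open>2\<close>, and the at least two off-diagonal entries of the row make up for it
  with at least \<open>1\<close> each.
\<close>

theorem card_M_dvd_card_twists:
  assumes e: "\<And>i. i \<in> I \<Longrightarrow> 3 \<le> e i" and rank: "3 \<le> card I"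
  shows "card (carrier M) dvd card twists"
  unfolding card_M card_twists
proof (rule prod_dvd_prod)
  fix i assume i: "i \<in> I"
  have "e i \<le> (e i - 2) + card (I - {i})"
    using rank finite_I i e[OF i] by simp
  also have "\<dots> \<le> (e i - 2) + (\<Sum>j\<in>I - {i}. min (e i) (e j) - 2)"
    unfolding card_eq_sum
  proof (intro add_left_mono sum_mono)
    fix j assume "j \<in> I - {i}"
    then show "1 \<le> min (e i) (e j) - 2" using e[OF i] e[of j] by simp
  qed
  also have "\<dots> = (\<Sum>j\<in>I. min (e i) (e j) - 2)"
    using finite_I i by (subst sum.remove) auto
  finally show "p ^ e i dvd (\<Prod>j\<in>I. p ^ (min (e i) (e j) - 2))"
    by (simp add: le_imp_power_dvd flip: power_sum)
qed

end

section \<open>Twisting the centre by matrices\<close>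

locale group_with_factored_center = group G + cyclic_factors p I e
  for G (structure) and p :: nat and I :: "'i set" and e :: "'i \<Rightarrow> nat" +
  fixes h g
  assumes isos: "group_isomorphisms (center_group G) M h g"
begin

lemma center_subset: "z \<in> center G \<Longrightarrow> z \<in> carrier G"
  by (simp add: center_def)

lemma carrier_center_group [simp]: "carrier (center_group G) = center G"
  by (simp add: center_group_def)

lemma h_hom: "h \<in> hom (center_group G) M" and g_hom: "g \<in> hom M (center_group G)"
  and g_h: "z \<in> center G \<Longrightarrow> g (h z) = z" and h_g: "x \<in> carrier M \<Longrightarrow> h (g x) = x"
  using isos by (auto simp: group_isomorphisms_def)

lemma h_closed: "z \<in> center G \<Longrightarrow> h z \<in> carrier M"
  using hom_in_carrier[OF h_hom] by simp

lemma g_closed: "x \<in> carrier M \<Longrightarrow> g x \<in> center G"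
  using hom_in_carrier[OF g_hom] by simp

text \<open>
  Twists of the product of cyclic groups are moved to the centre along the isomorphism \<open>h\<close> with
  inverse \<open>g\<close>. The result is made undefined outside the centre so that it can be an element of the
  group of bijections of the centre.
\<close>

definition transport :: "(('i \<Rightarrow> int) \<Rightarrow> ('i \<Rightarrow> int)) \<Rightarrow> 'a \<Rightarrow> 'a"
  where "transport t = (\<lambda>z\<in>center G. g (t (h z)))"

lemma transport_inj: "inj_on transport twists"
proof (rule inj_onI)
  fix s t assume s: "s \<in> twists" and t: "t \<in> twists" and eq: "transport s = transport t"
  show "s = t"
  proof (rule extensionalityI[of _ "carrier M"])
    fix x assume x: "x \<in> carrier M"
    have "g (s x) = g (t x)"
      using fun_cong[OF eq, of "g x"] g_closed[OF x] by (simp add: transport_def h_g[OF x])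
    then show "s x = t x"
      using h_g[OF twists_closed[OF s x]] h_g[OF twists_closed[OF t x]] by metis
  qed (use s t in \<open>auto simp: twists_def\<close>)
qed

lemma transport_compose:
  assumes "t \<in> twists"
  shows "compose (center G) (transport s) (transport t) = transport (compose (carrier M) s t)"
proof -
  have "h (g (t (h z))) = t (h z)" "t (h z) \<in> carrier M" if "z \<in> center G" for z
    using twists_closed[OF assms h_closed[OF that]] h_g by simp_all
  then show ?thesis
    using h_closed g_closed by (simp add: compose_def transport_def cong: restrict_cong)
qed

text \<open>
  Transport turns \<open>1 + p\<^sup>2K\<close> into \<open>z \<mapsto> z \<alpha>(z)\<^bsup>p\<^sup>2\<^esup>\<close>, where the endomorphism \<open>\<alpha>\<close> of the centre corresponds to
  the matrix \<open>K\<close>. As \<open>\<alpha>(z)\<^bsup>p\<^sup>2\<^esup> = \<alpha>(z\<^bsup>p\<^sup>2\<^esup>)\<close>, and the right-hand side makes sense for every element of \<open>G\<close>, the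
  same formula defines the extension.
\<close>

lemma transport_extends:
  assumes fin: "finite (carrier G)"
    and ab: "power_abelian (p\<^sup>2) G"
    and central: "\<And>x. x \<in> carrier G \<Longrightarrow> x [^] (p\<^sup>2) \<in> center G"
    and exp: "\<And>x. x \<in> carrier G \<Longrightarrow> x [^] ((p\<^sup>2) ^ k) = \<one>"
    and t: "t \<in> twists"
  shows "\<exists>f\<in>auto G. transport t = restrict f (center G)"
proof -
  obtain K where K: "compatible K" and t: "t = restrict (twist K) (carrier M)"
    using t by (auto simp: twists_def)
  define \<alpha> where "\<alpha> = g \<circ> (matrix_map K \<circ> h)"
  have \<alpha>: "\<alpha> \<in> hom (center_group G) (center_group G)"
    unfolding \<alpha>_def using Group.hom_compose[OF Group.hom_compose[OF h_hom matrix_map_hom[OF K]] g_hom] .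
  let ?f = "\<lambda>x\<in>carrier G. x \<otimes> \<alpha> (x [^] (p\<^sup>2))"
  have "?f \<in> auto G"
    using power_twist_in_auto[OF fin ab central exp \<alpha>] .
  moreover have "transport t z = ?f z" if z: "z \<in> center G" for z
  proof -
    let ?y = "matrix_map K (h z)"
    interpret Z: group "center_group G" by (rule group_center_group)
    interpret \<alpha>: group_hom "center_group G" "center_group G" \<alpha>
      using \<alpha> by (simp add: group_hom_def group_hom_axioms_def Z.is_group)
    interpret g: group_hom M "center_group G" g
      using g_hom group_M by (simp add: group_hom_def group_hom_axioms_def Z.is_group)
    have y: "?y \<in> carrier M"
      using hom_in_carrier[OF matrix_map_hom[OF K] h_closed[OF z]] .
    have "transport t z = g (h z \<otimes>\<^bsub>M\<^esub> ?y [^]\<^bsub>M\<^esub> (p\<^sup>2))"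
      using z h_closed[OF z] twist_eq_mult_pow[OF h_closed[OF z], of K]
      by (simp only: transport_def t restrict_apply if_True)
    also have "\<dots> = g (h z) \<otimes>\<^bsub>center_group G\<^esub> g ?y [^]\<^bsub>center_group G\<^esub> (p\<^sup>2)"
      by (simp only: g.hom_mult[OF h_closed[OF z] g.G.nat_pow_closed[OF y]] g.hom_nat_pow[OF y])
    also have "\<dots> = z \<otimes>\<^bsub>center_group G\<^esub> \<alpha> (z [^]\<^bsub>center_group G\<^esub> (p\<^sup>2))"
      using z \<alpha>.hom_nat_pow[of z "p\<^sup>2"] g_h[OF z] by (simp add: \<alpha>_def)
    also have "\<dots> = ?f z"
      using center_subset[OF z] by (simp add: center_group_def nat_pow_consistent[symmetric])
    finally show ?thesis .
  qed
  then have "transport t = restrict ?f (center G)"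
    by (auto simp: transport_def fun_eq_iff)
  ultimately show ?thesis by blast
qed

text \<open>
  Being restrictions of automorphisms, the transported twists are bijections of the centre; they form
  a finite set closed under composition.
\<close>

lemma subgroup_transport_twists:
  assumes fin: "finite (carrier G)"
    and ext: "\<And>t. t \<in> twists \<Longrightarrow> \<exists>f\<in>auto G. transport t = restrict f (center G)"
  shows "subgroup (transport ` twists) (BijGroup (center G))"
proof (rule group.finite_mult_closed_imp_subgroup[OF group_BijGroup])
  have Bij: "transport t \<in> Bij (center G)" if "t \<in> twists" for t
    using ext[OF that] restrict_center_in_Bij[OF fin] by auto
  then show "transport ` twists \<subseteq> carrier (BijGroup (center G))"
    by (auto simp: BijGroup_def)
  show "finite (transport ` twists)" "transport ` twists \<noteq> {}"
    using finite_twists twists_nonempty by simp_all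
  fix a b assume "a \<in> transport ` twists" "b \<in> transport ` twists"
  then obtain s t where st: "s \<in> twists" "t \<in> twists" "a = transport s" "b = transport t" by blast
  have "a \<otimes>\<^bsub>BijGroup (center G)\<^esub> b = transport (compose (carrier M) s t)"
    using st Bij by (simp add: BijGroup_def transport_compose)
  then show "a \<otimes>\<^bsub>BijGroup (center G)\<^esub> b \<in> transport ` twists"
    using compose_twists[OF st(1,2)] by simp
qed

end

section \<open>Divisibility\<close>

theorem theorem1:
  fixes G :: "('a, 'b) monoid_scheme" and p n :: nat and e :: "nat \<Rightarrow> nat"
  assumes "Factorial_Ring.prime p" and "odd p"
    and "finite_p_group p G"
    and "\<not> comm_group G"
    and "power_abelian (p ^ 2) G"
    and "p_central p G"
    and "order G \<ge> p ^ 3"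
    and "n \<ge> 3"
    and "\<forall>i \<in> {1..n}. 3 \<le> e i"
    and "mono_on {1..n} e"
    and "center_group G \<cong> product_group {1..n} (\<lambda>i. integer_mod_group (p ^ e i))"
  shows "order G dvd order (AutoGroup G)"
proof -
  interpret group G using assms(3) by (simp add: finite_p_group_def)
  have fin: "finite (carrier G)" using assms(3) by (simp add: finite_p_group_def)
  obtain k where k: "order G = p ^ k" using assms(3) by (auto simp: finite_p_group_def)
  have e: "3 \<le> e i" if "i \<in> {1..n}" for i using assms(9) that by blast
  interpret cyclic_factors p "{1..n}" e
  proof
    show "1 < p" using assms(1) by (rule prime_gt_1_nat)
    show "2 \<le> e i" if "i \<in> {1..n}" for i using e[OF that] by simp
  qed simp
  have iso: "center_group G \<cong> M" using assms(11) by (simp only: M_def)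
  then obtain h where h: "h \<in> iso (center_group G) M" by (auto simp: is_iso_def)
  then obtain g where "group_isomorphisms (center_group G) M h g"
    using group.iso_iff_group_isomorphisms[OF group_center_group] by blast
  then interpret group_with_factored_center G p "{1..n}" e h g
    by unfold_locales
  have "x [^]\<^bsub>G\<^esub> (p\<^sup>2) \<in> center G" if x: "x \<in> carrier G" for x
  proof -
    have "x [^]\<^bsub>G\<^esub> p \<in> power_subgroup p G"
      unfolding power_subgroup_def using x by (blast intro: generate.incl)
    then have "x [^]\<^bsub>G\<^esub> p \<in> center G" using assms(6) by (auto simp: p_central_def)
    then have "(x [^]\<^bsub>G\<^esub> p) [^]\<^bsub>G\<^esub> p \<in> center G"
      using monoid.nat_pow_closed[OF group.is_monoid[OF group_center_group], of "x [^]\<^bsub>G\<^esub> p" p]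
      by (simp add: center_group_def nat_pow_consistent[symmetric])
    then show ?thesis using x by (simp add: nat_pow_pow power2_eq_square)
  qed
  moreover have "x [^]\<^bsub>G\<^esub> ((p\<^sup>2) ^ k) = \<one>\<^bsub>G\<^esub>" if x: "x \<in> carrier G" for x
  proof -
    \<comment> \<open>The descent in \<open>power_twist_in_auto\<close> runs through powers of \<open>p\<^sup>2\<close>, while \<open>|G| = p ^ k\<close> need not be one.\<close>
    have "(p\<^sup>2) ^ k = order G * p ^ k" by (simp add: k power2_eq_square power_mult_distrib)
    then show ?thesis using x pow_order_eq_1 by (simp add: nat_pow_pow[symmetric])
  qed
  ultimately have ext: "\<exists>f\<in>auto G. transport t = restrict f (center G)" if "t \<in> twists" for t
    using transport_extends[OF fin assms(5) _ _ that] by blast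
  show ?thesis
  proof (rule order_dvd_order_AutoGroup_if_center_automorphisms_extend[OF fin])
    show "subgroup (transport ` twists) (BijGroup (center G))"
      using fin ext by (rule subgroup_transport_twists)
    show "\<exists>f\<in>auto G. s = restrict f (center G)" if "s \<in> transport ` twists" for s
      using that ext by blast
    have "card (center G) = card (carrier M)"
      using iso_same_card[OF iso] by simp
    also have "\<dots> dvd card twists"
      using e assms(8) by (intro card_M_dvd_card_twists) simp_all
    also have "card twists = card (transport ` twists)"
      using transport_inj by (rule card_image[symmetric])
    finally show "card (center G) dvd card (transport ` twists)" .
  qed
qed

end
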